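(* Let $f:\mathbb{Z}_N\to\mathbb{C}$ and let $n:\mathbb{Z}_N\to\mathbb{C}$ be any perturbation. If $\|\widehat n\|_2<\|\widehat f\|_2$, then $$\big|\mathrm{FR}(f+n)-\mathrm{FR}(f)\big|\le\frac{\|\widehat n\|_1+\mathrm{FR}(f)\|\widehat n\|_2}{\|\widehat f\|_2-\|\widehat n\|_2}.$$ Moreover, using $\|\widehat n\|_1\le\sqrt N\|\widehat n\|_2$ and $\mathrm{FR}(f)\le\sqrt N$, we have $$\big|\mathrm{FR}(f+n)-\mathrm{FR}(f)\big|\le\frac{(\sqrt N+\mathrm{FR}(f))\|\widehat n\|_2}{\|\widehat f\|_2-\|\widehat n\|_2}\le\frac{2\sqrt N\,\|\widehat n\|_2}{\|\widehat f\|_2-\|\widehat n\|_2}.$$ In particular, if $\|\widehat n\|_2\le\frac12\|\widehat f\|_2$ (with $f$ nonzero), then $$\big|\mathrm{FR}(f+n)-\mathrm{FR}(f)\big|\le2\left(\frac{\|\widehat n\|_2}{\|\widehat f\|_2}\right)\left(\sqrt N+\mathrm{FR}(f)\right).$$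
   Context: $N$ is a positive integer and $\mathbb{Z}_N=\mathbb{Z}/N\mathbb{Z}$. For $f:\mathbb{Z}_N\to\mathbb{C}$ the unitary Fourier transform is $\widehat f(m)=N^{-1/2}\sum_{x\in\mathbb{Z}_N}e^{-2\pi i xm/N}f(x)$. $\|g\|_p=\left(\sum_{x\in\mathbb{Z}_N}|g(x)|^p\right)^{1/p}$. The Fourier ratio of a nonzero $f$ is $\mathrm{FR}(f)=\|\widehat f\|_1/\|\widehat f\|_2$. *)

theory Defs
  imports "HOL-Analysis.Analysis" "Berlekamp_Zassenhaus.Finite_Field"
begin

text \<open>
  The ring \<open>\<int>/N\<int>\<close> is the type \<open>'a mod_ring\<close> with \<open>N = CARD('a)\<close>; the index type
  \<open>'a\<close> is an arbitrary finite type, so \<open>N\<close> is an arbitrary positive integer (including 1).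
  The function \<open>to_int_mod_ring\<close> picks the representative in \<open>{0..<N}\<close>; the kernel
  \<open>exp (- 2 * pi * \<i> * x * m / N)\<close> does not depend on this choice.
\<close>

definition fourier :: "('a::finite mod_ring \<Rightarrow> complex) \<Rightarrow> 'a mod_ring \<Rightarrow> complex" where
  "fourier f m = (1 / complex_of_real (sqrt (real CARD('a)))) *
     (\<Sum>x\<in>UNIV. exp (- (2 * complex_of_real pi * \<i> * of_int (to_int_mod_ring x)
                         * of_int (to_int_mod_ring m)) / of_nat CARD('a)) * f x)"

definition lp_norm :: "real \<Rightarrow> ('a::finite mod_ring \<Rightarrow> complex) \<Rightarrow> real" where
  "lp_norm p g = (\<Sum>x\<in>UNIV. norm (g x) powr p) powr (1 / p)"

text \<open>The Fourier ratio is meaningful only for nonzero \<open>f\<close>; for \<open>f = 0\<close> it takes the value 0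
  because of the convention \<open>x / 0 = 0\<close>.\<close>

definition fourier_ratio :: "('a::finite mod_ring \<Rightarrow> complex) \<Rightarrow> real" where
  "fourier_ratio f = lp_norm 1 (fourier f) / lp_norm 2 (fourier f)"

end

theory Submission
  imports Defs
begin

text \<open>Let \<open>A\<close>, \<open>B\<close> be the 1-norm and 2-norm of
  \<open>fourier f\<close>, and \<open>a\<close>, \<open>b\<close> those of
  \<open>fourier n\<close>. The transform is additive (\<open>fourier_add\<close>), so by the
  reverse triangle inequality (\<open>abs_lp_norm_add_diff_le\<close>) the perturbation moves
  \<open>A\<close> by at most \<open>a\<close> and \<open>B\<close> by at most \<open>b\<close>. The
  rest is a stability estimate for a quotient of reals, \<open>ratio_perturbation\<close>, which
  yields the first bound. Cauchy-Schwarz (\<open>lp_norm_1_le_lp_norm_2\<close>) bounds both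
  \<open>a / b\<close> and \<open>A / B\<close> by the square root of N, which gives the weaker
  bounds; when \<open>b\<close> is at most half of \<open>B\<close>, the denominator
  \<open>B - b\<close> is at least \<open>B / 2\<close>.\<close>

lemma fourier_add: "fourier (\<lambda>x. f x + g x) m = fourier f m + fourier g m"
  by (simp add: fourier_def sum.distrib algebra_simps)

lemma lp_norm_1: "lp_norm 1 g = (\<Sum>x\<in>UNIV. norm (g x))"
  by (simp add: lp_norm_def sum_nonneg)

lemma lp_norm_2: "lp_norm 2 g = L2_set (\<lambda>x. norm (g x)) UNIV"
  by (simp add: lp_norm_def L2_set_def powr_half_sqrt sum_nonneg)

lemma lp_norm_nonneg [simp]: "0 \<le> lp_norm p g"
  by (simp add: lp_norm_def)

lemma lp_norm_1_triangle: "lp_norm 1 (\<lambda>x. f x + g x) \<le> lp_norm 1 f + lp_norm 1 g"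
  by (simp add: lp_norm_1 flip: sum.distrib) (intro sum_mono norm_triangle_ineq)

lemma lp_norm_2_triangle: "lp_norm 2 (\<lambda>x. f x + g x) \<le> lp_norm 2 f + lp_norm 2 g"
proof -
  have "lp_norm 2 (\<lambda>x. f x + g x) \<le> L2_set (\<lambda>x. norm (f x) + norm (g x)) UNIV"
    unfolding lp_norm_2 by (intro L2_set_mono norm_triangle_ineq) auto
  also have "\<dots> \<le> lp_norm 2 f + lp_norm 2 g"
    unfolding lp_norm_2 by (rule L2_set_triangle_ineq)
  finally show ?thesis .
qed

lemma lp_norm_uminus: "lp_norm p (\<lambda>x. - g x) = lp_norm p g"
  by (simp add: lp_norm_def)

text \<open>One direction is the triangle inequality for \<open>g + h\<close>, the other the same
  inequality for \<open>g = (g + h) + (- h)\<close>. Taking it as an assumption lets one proof serve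
  both p = 1 and p = 2.\<close>

lemma abs_lp_norm_add_diff_le:
  fixes g h :: "'a::finite mod_ring \<Rightarrow> complex"
  assumes triangle: "\<And>g h :: 'a mod_ring \<Rightarrow> complex. lp_norm p (\<lambda>x. g x + h x) \<le> lp_norm p g + lp_norm p h"
  shows "\<bar>lp_norm p (\<lambda>x. g x + h x) - lp_norm p g\<bar> \<le> lp_norm p h"
  using triangle[of g h] triangle[of "\<lambda>x. g x + h x" "\<lambda>x. - h x"]
  by (simp add: lp_norm_uminus)

text \<open>Cauchy-Schwarz against the constant function 1, whose 2-norm is the square root of the
  number of residues.\<close>

lemma lp_norm_1_le_lp_norm_2:
  fixes g :: "'a::finite mod_ring \<Rightarrow> complex"
  shows "lp_norm 1 g \<le> sqrt (real CARD('a)) * lp_norm 2 g"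
proof -
  have "CARD('a mod_ring) = CARD('a)"
    by simp
  then have "L2_set (\<lambda>_. 1) (UNIV :: 'a mod_ring set) = sqrt (real CARD('a))"
    by (simp add: L2_set_def)
  then show ?thesis
    using L2_set_mult_ineq[of "\<lambda>_. 1" "\<lambda>x. norm (g x)" UNIV]
    by (simp add: lp_norm_1 lp_norm_2)
qed

lemma fourier_ratio_nonneg: "0 \<le> fourier_ratio f"
  by (simp add: fourier_ratio_def)

text \<open>If the 2-norm of the transform vanishes, the ratio is 0 by the division convention;
  otherwise the Cauchy-Schwarz bound is divided by it.\<close>

lemma fourier_ratio_le:
  fixes f :: "'a::finite mod_ring \<Rightarrow> complex"
  shows "fourier_ratio f \<le> sqrt (real CARD('a))"
  using lp_norm_1_le_lp_norm_2[of "fourier f"]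
  by (auto simp: fourier_ratio_def divide_le_eq leD[OF lp_norm_nonneg])

text \<open>Since \<open>A / B * B = A\<close>, the numerator \<open>A' - A / B * B'\<close> splits
  as \<open>(A' - A) + A / B * (B - B')\<close>. An error in the denominator is thus weighted by the
  original ratio.\<close>

lemma ratio_perturbation:
  fixes A A' B B' a b :: real
  assumes A: "\<bar>A' - A\<bar> \<le> a" and B: "\<bar>B' - B\<bar> \<le> b" and "b < B" and "0 \<le> A"
  shows "\<bar>A' / B' - A / B\<bar> \<le> (a + A / B * b) / (B - b)"
proof -
  have pos: "0 < B" "0 < B'" "B - b \<le> B'" "0 \<le> a"
    using assms by linarith+
  have "A' / B' - A / B = ((A' - A) + A / B * (B - B')) / B'"
    using pos by (simp add: field_simps)
  then have "\<bar>A' / B' - A / B\<bar> = \<bar>(A' - A) + A / B * (B - B')\<bar> / B'"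
    using pos by simp
  also have "\<dots> \<le> (a + A / B * b) / B'"
  proof -
    have "\<bar>A / B * (B - B')\<bar> \<le> A / B * b"
      using assms pos by (simp only: abs_mult) (intro mult_mono; simp add: abs_minus_commute)
    then show ?thesis
      using A pos by (intro divide_right_mono) linarith+
  qed
  \<comment> \<open>The numerator is nonnegative and \<open>B'\<close> is at least
    \<open>B - b\<close>, which is positive.\<close>
  also have "\<dots> \<le> (a + A / B * b) / (B - b)"
    using assms pos by (intro divide_left_mono add_nonneg_nonneg mult_nonneg_nonneg) auto
  finally show ?thesis .
qed

lemma fourier_ratio_perturbation:
  assumes "lp_norm 2 (fourier n) < lp_norm 2 (fourier f)"
  shows "\<bar>fourier_ratio (\<lambda>x. f x + n x) - fourier_ratio f\<bar>
    \<le> (lp_norm 1 (fourier n) + fourier_ratio f * lp_norm 2 (fourier n))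
       / (lp_norm 2 (fourier f) - lp_norm 2 (fourier n))"
proof -
  have eq: "fourier (\<lambda>x. f x + n x) = (\<lambda>m. fourier f m + fourier n m)"
    by (rule ext) (rule fourier_add)
  show ?thesis
    unfolding fourier_ratio_def eq
    using assms
    by (intro ratio_perturbation abs_lp_norm_add_diff_le lp_norm_1_triangle lp_norm_2_triangle
        lp_norm_nonneg)
qed

theorem theorem1p32:
  fixes f n :: "'a::finite mod_ring \<Rightarrow> complex"
  defines "N \<equiv> CARD('a)"
  shows
    "(lp_norm 2 (fourier n) < lp_norm 2 (fourier f) \<longrightarrow>
        \<bar>fourier_ratio (\<lambda>x. f x + n x) - fourier_ratio f\<bar>
          \<le> (lp_norm 1 (fourier n) + fourier_ratio f * lp_norm 2 (fourier n))
             / (lp_norm 2 (fourier f) - lp_norm 2 (fourier n)))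
   \<and> lp_norm 1 (fourier n) \<le> sqrt (real N) * lp_norm 2 (fourier n)
   \<and> (f \<noteq> (\<lambda>_. 0) \<longrightarrow> fourier_ratio f \<le> sqrt (real N))
   \<and> (lp_norm 2 (fourier n) < lp_norm 2 (fourier f) \<longrightarrow>
        \<bar>fourier_ratio (\<lambda>x. f x + n x) - fourier_ratio f\<bar>
          \<le> (sqrt (real N) + fourier_ratio f) * lp_norm 2 (fourier n)
             / (lp_norm 2 (fourier f) - lp_norm 2 (fourier n))
      \<and> (sqrt (real N) + fourier_ratio f) * lp_norm 2 (fourier n)
             / (lp_norm 2 (fourier f) - lp_norm 2 (fourier n))
          \<le> 2 * sqrt (real N) * lp_norm 2 (fourier n)
             / (lp_norm 2 (fourier f) - lp_norm 2 (fourier n)))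
   \<and> (f \<noteq> (\<lambda>_. 0) \<and> lp_norm 2 (fourier n) \<le> 1 / 2 * lp_norm 2 (fourier f) \<longrightarrow>
        \<bar>fourier_ratio (\<lambda>x. f x + n x) - fourier_ratio f\<bar>
          \<le> 2 * (lp_norm 2 (fourier n) / lp_norm 2 (fourier f))
             * (sqrt (real N) + fourier_ratio f))"
proof -
  let ?a = "lp_norm 2 (fourier n)" and ?b = "lp_norm 2 (fourier f)"
  let ?R = "fourier_ratio f" and ?D = "\<bar>fourier_ratio (\<lambda>x. f x + n x) - fourier_ratio f\<bar>"
  have R: "?R \<le> sqrt (real N)"
    unfolding N_def by (rule fourier_ratio_le)
  have n1: "lp_norm 1 (fourier n) \<le> sqrt (real N) * ?a"
    unfolding N_def by (rule lp_norm_1_le_lp_norm_2)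
  have bound1: "?D \<le> (sqrt (real N) + ?R) * ?a / (?b - ?a)" if less: "?a < ?b"
  proof -
    have "?D \<le> (lp_norm 1 (fourier n) + ?R * ?a) / (?b - ?a)"
      using less by (rule fourier_ratio_perturbation)
    also have "\<dots> \<le> (sqrt (real N) + ?R) * ?a / (?b - ?a)"
      using less n1 by (intro divide_right_mono) (auto simp: algebra_simps)
    finally show ?thesis .
  qed
  have bound2: "(sqrt (real N) + ?R) * ?a / (?b - ?a) \<le> 2 * sqrt (real N) * ?a / (?b - ?a)"
    if "?a < ?b"
    using that R by (intro divide_right_mono mult_right_mono) auto
  have bound3: "?D \<le> 2 * (?a / ?b) * (sqrt (real N) + ?R)" if half: "?a \<le> 1 / 2 * ?b"
  \<comment> \<open>The assumption \<open>half\<close> forces the strict inequality needed by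
    \<open>bound1\<close> only when \<open>?b\<close> is positive.\<close>
  proof (cases "?b = 0")
    case True
    \<comment> \<open>Both Fourier ratios are then \<open>x / 0 = 0\<close>.\<close>
    moreover have "?a = 0"
      using True half lp_norm_nonneg[of 2 "fourier n"] by linarith
    ultimately have "lp_norm 2 (fourier (\<lambda>x. f x + n x)) = 0"
      using lp_norm_2_triangle[of "fourier f" "fourier n"]
      by (intro order.antisym) (simp_all add: fourier_add[abs_def])
    with True show ?thesis
      by (simp add: fourier_ratio_def)
  next
    case False
    then have b: "0 < ?b"
      using lp_norm_nonneg[of 2 "fourier f"] by linarith
    with half have less: "?a < ?b" by linarith
    have "?D \<le> (sqrt (real N) + ?R) * ?a / (?b - ?a)"
      using less by (rule bound1)
    \<comment> \<open>By \<open>half\<close>, \<open>?b - ?a\<close> is at least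
      \<open>?b / 2\<close>; this is the source of the factor 2.\<close>
    also have "\<dots> \<le> (sqrt (real N) + ?R) * ?a / (?b / 2)"
      using b half less fourier_ratio_nonneg[of f]
      by (intro divide_left_mono mult_nonneg_nonneg add_nonneg_nonneg) auto
    also have "\<dots> = 2 * (?a / ?b) * (sqrt (real N) + ?R)"
      by simp
    finally show ?thesis .
  qed
  show ?thesis
    using fourier_ratio_perturbation[of n f] n1 R bound1 bound2 bound3 by blast
qed

end
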